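(* Let $\mathfrak{L}$ be a solvable left Leibniz algebra. If $M$ is a finite-dimensional right faithful irreducible $\mathfrak{L}$-bimodule, then $\mathrm{HL}^n(\mathfrak{L},M)=0$ for every non-negative integer $n$.
   Context: All vector spaces and algebras are over an arbitrary field $\mathbb{F}$. A left Leibniz algebra over $\mathbb{F}$ is an $\mathbb{F}$-vector space $\mathfrak{L}$ with a bilinear multiplication satisfying $x(yz)=(xy)z+y(xz)$ for all $x,y,z\in\mathfrak{L}$. It is solvable if its derived series $\mathfrak{L}^{(0)}=\mathfrak{L}$, $\mathfrak{L}^{(i+1)}=\langle xy\mid x,y\in\mathfrak{L}^{(i)}\rangle_{\mathbb{F}}$ reaches $0$. An $\mathfrak{L}$-bimodule is an $\mathbb{F}$-vector space $M$ with bilinear left and right actions of $\mathfrak{L}$ such that $(xy)\cdot m=x\cdot(y\cdot m)-y\cdot(x\cdot m)$, $(x\cdot m)\cdot y=x\cdot(m\cdot y)-m\cdot(xy)$, and $(m\cdot x)\cdot y=m\cdot(xy)-x\cdot(m\cdot y)$ for all $m\in M$, $x,y\in\mathfrak{L}$. $M$ is irreducible if it is non-zero and has no subbimodules other than $0$ and $M$. $M$ is right faithful if its right annihilator $\{x\in\mathfrak{L}\mid m\cdot x=0\text{ for all }m\in M\}$ is zero. Leibniz cohomology: for $n\ge 0$ let $\mathrm{CL}^n(\mathfrak{L},M):=\mathrm{Hom}_{\mathbb{F}}(\mathfrak{L}^{\otimes n},M)$ and $\mathrm{d}^n:\mathrm{CL}^n(\mathfrak{L},M)\to\mathrm{CL}^{n+1}(\mathfrak{L},M)$,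 $$(\mathrm{d}^nf)(x_1\otimes\dots\otimes x_{n+1})=\sum_{j=1}^n(-1)^{j+1}x_j\cdot f(x_1\otimes\dots\otimes\hat{x}_j\otimes\dots\otimes x_{n+1})+(-1)^{n+1}f(x_1\otimes\dots\otimes x_n)\cdot x_{n+1}+\sum_{1\le i<j\le n+1}(-1)^if(x_1\otimes\dots\otimes\hat{x}_i\otimes\dots\otimes x_{j-1}\otimes x_ix_j\otimes x_{j+1}\otimes\dots\otimes x_{n+1}).$$ This is a cochain complex, and $\mathrm{HL}^n(\mathfrak{L},M):=\operatorname{Ker}(\mathrm{d}^n)/\operatorname{Im}(\mathrm{d}^{n-1})$ with $\mathrm{d}^{-1}:=0$.
   Formalization: For n = 0 the algebra is assumed to be non-zero: over the zero algebra a one-dimensional module is irreducible and vacuously right faithful, but its cohomology in degree 0 is the module itself, which is non-zero. *)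

theory Defs
  imports Complex_Main
begin

locale left_leibniz_algebra =
  L: vector_space scaleL
  for scaleL :: "'f::field \<Rightarrow> 'l::ab_group_add \<Rightarrow> 'l" (infixr "*\<^sub>L" 75) +
  fixes mult :: "'l \<Rightarrow> 'l \<Rightarrow> 'l" (infixl "\<bullet>" 70)
  assumes linear_mult_right: "\<And>x. Vector_Spaces.linear scaleL scaleL (\<lambda>y. x \<bullet> y)"
    and linear_mult_left: "\<And>y. Vector_Spaces.linear scaleL scaleL (\<lambda>x. x \<bullet> y)"
    and leibniz: "\<And>x y z. x \<bullet> (y \<bullet> z) = (x \<bullet> y) \<bullet> z + y \<bullet> (x \<bullet> z)"
begin

primrec derived :: "nat \<Rightarrow> 'l set" where
  "derived 0 = UNIV"
| "derived (Suc i) = L.span {x \<bullet> y | x y. x \<in> derived i \<and> y \<in> derived i}"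

definition solvable :: bool where
  "solvable \<longleftrightarrow> (\<exists>i. derived i = {0})"

end

locale leibniz_bimodule =
  left_leibniz_algebra scaleL mult + M: vector_space scaleM
  for scaleL :: "'f::field \<Rightarrow> 'l::ab_group_add \<Rightarrow> 'l" (infixr "*\<^sub>L" 75)
    and mult :: "'l \<Rightarrow> 'l \<Rightarrow> 'l" (infixl "\<bullet>" 70)
    and scaleM :: "'f \<Rightarrow> 'm::ab_group_add \<Rightarrow> 'm" (infixr "*\<^sub>M" 75) +
  fixes lact :: "'l \<Rightarrow> 'm \<Rightarrow> 'm" (infixr "\<rhd>" 70)
    and ract :: "'m \<Rightarrow> 'l \<Rightarrow> 'm" (infixl "\<lhd>" 70)
  assumes linear_lact_right: "\<And>x. Vector_Spaces.linear scaleM scaleM (\<lambda>m. x \<rhd> m)"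
    and linear_lact_left: "\<And>m. Vector_Spaces.linear scaleL scaleM (\<lambda>x. x \<rhd> m)"
    and linear_ract_right: "\<And>m. Vector_Spaces.linear scaleL scaleM (\<lambda>x. m \<lhd> x)"
    and linear_ract_left: "\<And>x. Vector_Spaces.linear scaleM scaleM (\<lambda>m. m \<lhd> x)"
    and LLM: "\<And>x y m. (x \<bullet> y) \<rhd> m = (x \<rhd> (y \<rhd> m)) - (y \<rhd> (x \<rhd> m))"
    and LML: "\<And>x y m. (x \<rhd> m) \<lhd> y = (x \<rhd> (m \<lhd> y)) - (m \<lhd> (x \<bullet> y))"
    and MLL: "\<And>x y m. (m \<lhd> x) \<lhd> y = (m \<lhd> (x \<bullet> y)) - (x \<rhd> (m \<lhd> y))"
begin

definition finite_dimensional :: bool where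
  "finite_dimensional \<longleftrightarrow> (\<exists>B. finite B \<and> M.span B = UNIV)"

definition subbimodule :: "'m set \<Rightarrow> bool" where
  "subbimodule N \<longleftrightarrow> M.subspace N \<and> (\<forall>x. \<forall>m\<in>N. x \<rhd> m \<in> N \<and> m \<lhd> x \<in> N)"

definition irreducible_bimodule :: bool where
  "irreducible_bimodule \<longleftrightarrow>
     (UNIV :: 'm set) \<noteq> {0} \<and> (\<forall>N. subbimodule N \<longrightarrow> N = {0} \<or> N = UNIV)"

definition right_annihilator :: "'l set" where
  "right_annihilator = {x. \<forall>m. m \<lhd> x = 0}"

definition right_faithful :: bool where
  "right_faithful \<longleftrightarrow> right_annihilator = {0}"

text \<open>
  A linear map from the \<open>n\<close>-th tensor power of the algebra to the bimodule is represented by the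
  corresponding multilinear map: \<open>f [x\<^sub>1, \<dots>, x\<^sub>n]\<close> is the value on the elementary tensor of
  \<open>x\<^sub>1, \<dots>, x\<^sub>n\<close>. Setting \<open>f\<close> to \<open>0\<close> on lists of any other length makes the representing function
  unique.
\<close>

definition cochains :: "nat \<Rightarrow> ('l list \<Rightarrow> 'm) set" where
  "cochains n = {f.
     (\<forall>xs. length xs \<noteq> n \<longrightarrow> f xs = 0) \<and>
     (\<forall>xs k. length xs = n \<and> k < n \<longrightarrow> Vector_Spaces.linear scaleL scaleM (\<lambda>x. f (xs[k := x])))}"

definition omit :: "nat \<Rightarrow> 'a list \<Rightarrow> 'a list" where
  "omit i xs = take i xs @ drop (Suc i) xs"

text \<open>
  List positions count from \<open>0\<close>, whereas the arguments of a cochain are usually numbered from \<open>1\<close>;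
  with \<open>i\<close> and \<open>j\<close> shifted by one, the usual signs \<open>(-1)^(j+1)\<close> and \<open>(-1)^i\<close> of the first and the
  last sum become \<open>(-1)^j\<close> and \<open>(-1)^(i+1)\<close>.
\<close>

definition coboundary_map :: "nat \<Rightarrow> ('l list \<Rightarrow> 'm) \<Rightarrow> 'l list \<Rightarrow> 'm" where
  "coboundary_map n f = (\<lambda>xs. if length xs \<noteq> Suc n then 0 else
     (\<Sum>j<n. (- 1) ^ j *\<^sub>M (xs ! j \<rhd> f (omit j xs)))
     + (- 1) ^ (n + 1) *\<^sub>M (f (take n xs) \<lhd> xs ! n)
     + (\<Sum>j\<le>n. \<Sum>i<j. (- 1) ^ (i + 1) *\<^sub>M f (omit i (xs[j := xs ! i \<bullet> xs ! j]))))"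

definition cocycles :: "nat \<Rightarrow> ('l list \<Rightarrow> 'm) set" where
  "cocycles n = {f \<in> cochains n. coboundary_map n f = (\<lambda>_. 0)}"

definition coboundaries :: "nat \<Rightarrow> ('l list \<Rightarrow> 'm) set" where
  "coboundaries n = (case n of 0 \<Rightarrow> {\<lambda>_. 0} | Suc k \<Rightarrow> coboundary_map k ` cochains k)"

definition cohomologous :: "nat \<Rightarrow> (('l list \<Rightarrow> 'm) \<times> ('l list \<Rightarrow> 'm)) set" where
  "cohomologous n =
     {(f, g). f \<in> cocycles n \<and> g \<in> cocycles n \<and> (\<lambda>xs. f xs - g xs) \<in> coboundaries n}"

text \<open>
  The elements of \<open>HL n\<close> are the cosets of the coboundaries in the cocycles, so \<open>HL n\<close> is the zero
  space iff it consists of the zero coset \<open>coboundaries n\<close> only.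
\<close>

definition HL :: "nat \<Rightarrow> ('l list \<Rightarrow> 'm) set set" where
  "HL n = cocycles n // cohomologous n"

text \<open>
  Over the zero algebra, a one-dimensional bimodule is irreducible and (vacuously) right faithful,
  but its cohomology in degree \<open>0\<close> does not vanish.
\<close>

lemma HL_0_zero_algebra:
  assumes "(UNIV :: 'l set) = {0}" and "(UNIV :: 'm set) \<noteq> {0}"
  shows "right_faithful" and "HL 0 \<noteq> {coboundaries 0}"
proof -
  interpret lin: Vector_Spaces.linear scaleL scaleM "\<lambda>x. m \<lhd> x" for m
    by (rule linear_ract_right)
  have z: "x = 0" for x :: 'l
    using assms(1) by blast
  have r0: "m \<lhd> x = 0" for m x
    using z[of x] lin.zero by simp
  show right_faithful
    unfolding right_faithful_def right_annihilator_def using assms(1) r0 by auto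
  obtain m :: 'm where m: "m \<noteq> 0"
    using assms(2) by blast
  define f where "f = (\<lambda>xs::'l list. if xs = [] then m else 0)"
  have f: "f \<in> cocycles 0"
    by (auto simp: cocycles_def cochains_def f_def coboundary_map_def r0)
  show "HL 0 \<noteq> {coboundaries 0}"
  proof
    assume "HL 0 = {coboundaries 0}"
    then have "cohomologous 0 `` {f} = {\<lambda>_. 0}"
      using quotientI[OF f, of "cohomologous 0"] by (simp add: HL_def coboundaries_def)
    moreover have "(f, f) \<in> cohomologous 0"
      using f by (simp add: cohomologous_def coboundaries_def)
    ultimately have "f = (\<lambda>_. 0)"
      by blast
    then show False
      using m by (auto simp: f_def dest: fun_cong[of _ _ "[]"])
  qed
qed

end

end

(*
  M is symmetric, and right faithfulness then makes L a Lie algebra. Let A be the last non-zero term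
  of the derived series, an abelian ideal. By Fitting's lemma and irreducibility every element of A
  acts on M bijectively or nilpotently, and not all of them nilpotently; so some a in A acts
  bijectively. On cochains the Lie derivative of a is the action of a minus a commuting nilpotent
  operator, because a(ax) = 0; hence it is invertible. By Cartan's formula it is also null-homotopic,
  so the cohomology vanishes.
*)

theory Submission
  imports Defs
begin

section \<open>Ideals from the derived series\<close>

context left_leibniz_algebra
begin

lemma mult_add_right: "x \<bullet> (y + z) = x \<bullet> y + x \<bullet> z"
  and mult_scale_right: "x \<bullet> (c *\<^sub>L y) = c *\<^sub>L (x \<bullet> y)"
  and mult_add_left: "(x + y) \<bullet> z = x \<bullet> z + y \<bullet> z"
  and mult_scale_left: "(c *\<^sub>L x) \<bullet> y = c *\<^sub>L (x \<bullet> y)"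
  using linear_mult_right[of x] linear_mult_left[of z] linear_mult_left[of y]
  by (simp_all add: Vector_Spaces.linear_iff)

lemma mult_zero_right [simp]: "x \<bullet> 0 = 0"
  using mult_add_right[of x 0 0] by simp

lemma subspace_derived: "L.subspace (derived i)"
  by (cases i) simp_all

text \<open>Left multiplication is a derivation: \<open>x \<bullet> (u \<bullet> v)\<close> splits
  into \<open>(x \<bullet> u) \<bullet> v\<close> and \<open>u \<bullet> (x \<bullet> v)\<close>,
  whose factors stay in the previous term by induction.\<close>

lemma derived_left_ideal: "y \<in> derived i \<Longrightarrow> x \<bullet> y \<in> derived i"
proof (induction i arbitrary: x y)
  case 0
  then show ?case by simp
next
  case (Suc i)
  let ?P = "{x \<bullet> y | x y. x \<in> derived i \<and> y \<in> derived i}"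
  from Suc.prems have "y \<in> L.span ?P" by simp
  then have "x \<bullet> y \<in> L.span ?P"
  proof (induction y rule: L.span_induct)
    case base
    show ?case
      by (rule L.subspaceI)
        (auto simp: mult_add_right mult_scale_right L.span_zero L.span_add L.span_scale)
  next
    case (step y)
    then obtain u v where uv: "y = u \<bullet> v" "u \<in> derived i" "v \<in> derived i" by blast
    have "(x \<bullet> u) \<bullet> v \<in> L.span ?P" "u \<bullet> (x \<bullet> v) \<in> L.span ?P"
      using uv Suc.IH by (blast intro: L.span_base)+
    then show ?case
      by (simp only: uv leibniz[of x u v] L.span_add)
  qed
  then show ?case by simp
qed

lemma ex_abelian_left_ideal:
  assumes solvable and "(UNIV :: 'l set) \<noteq> {0}"
  obtains A where "L.subspace A" "A \<noteq> {0}" "\<And>x a. a \<in> A \<Longrightarrow> x \<bullet> a \<in> A"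
    "\<And>a b. a \<in> A \<Longrightarrow> b \<in> A \<Longrightarrow> a \<bullet> b = 0"
proof -
  define i where "i = (LEAST i. derived i = {0})"
  have i: "derived i = {0}"
    using assms(1) unfolding i_def solvable_def by (rule LeastI_ex)
  \<comment> \<open>\<open>derived 0\<close> is the whole non-zero algebra, so there is a last
    non-zero term \<open>derived k\<close>, whose products all vanish.\<close>
  then obtain k where k: "i = Suc k"
    using assms(2) by (cases i) auto
  have "derived k \<noteq> {0}"
    using not_less_Least[of k "\<lambda>i. derived i = {0}"] k by (simp add: i_def)
  moreover have "a \<bullet> b = 0" if "a \<in> derived k" "b \<in> derived k" for a b
  proof -
    have "a \<bullet> b \<in> derived (Suc k)"
      unfolding derived.simps by (rule L.span_base) (use that in blast)
    then show ?thesis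
      using i k by simp
  qed
  ultimately show ?thesis
    using that[of "derived k"] subspace_derived derived_left_ideal by simp
qed

end

section \<open>Symmetry of irreducible right faithful bimodules\<close>

context leibniz_bimodule
begin

lemma lact_add_right: "x \<rhd> (m + m') = (x \<rhd> m) + (x \<rhd> m')"
  and lact_scale_right: "x \<rhd> (c *\<^sub>M m) = c *\<^sub>M (x \<rhd> m)"
  and lact_add_left: "(x + y) \<rhd> m = (x \<rhd> m) + (y \<rhd> m)"
  and lact_scale_left: "(c *\<^sub>L x) \<rhd> m = c *\<^sub>M (x \<rhd> m)"
  using linear_lact_right[of x] linear_lact_left[of m]
  by (simp_all add: Vector_Spaces.linear_iff)

lemma ract_add_right: "m \<lhd> (x + y) = (m \<lhd> x) + (m \<lhd> y)"
  and ract_add_left: "(m + m') \<lhd> x = (m \<lhd> x) + (m' \<lhd> x)"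
  and ract_scale_left: "(c *\<^sub>M m) \<lhd> x = c *\<^sub>M (m \<lhd> x)"
  using linear_ract_right[of m] linear_ract_left[of x]
  by (simp_all add: Vector_Spaces.linear_iff)

lemma lact_zero_right [simp]: "x \<rhd> 0 = 0"
  using lact_add_right[of x 0 0] by simp

lemma lact_zero_left [simp]: "0 \<rhd> m = 0"
  using lact_add_left[of 0 0 m] by simp

lemma ract_zero_right [simp]: "m \<lhd> 0 = 0"
  using ract_add_right[of m 0 0] by simp

lemma ract_zero_left [simp]: "0 \<lhd> x = 0"
  using ract_add_left[of 0 0 x] by simp

lemma lact_minus_right: "x \<rhd> (- m) = - (x \<rhd> m)"
  using lact_add_right[of x m "- m"] by (simp add: eq_neg_iff_add_eq_0 add.commute)

lemma lact_diff_right: "x \<rhd> (m - m') = (x \<rhd> m) - (x \<rhd> m')"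
  using lact_add_right[of x m "- m'"] by (simp add: lact_minus_right)

text \<open>The elements \<open>x \<rhd> m + m \<lhd> x\<close> span a subbimodule with zero right action.\<close>

lemma irreducible_right_faithful_symmetric:
  assumes irreducible_bimodule and right_faithful
  shows "m \<lhd> x = - (x \<rhd> m)"
proof -
  define G where "G = {(x \<rhd> m) + (m \<lhd> x) | x m. True}"
  \<comment> \<open>The right-hand sides of \<open>LML\<close> and \<open>MLL\<close> are negatives
    of each other.\<close>
  have G0: "g \<lhd> y = 0" if "g \<in> G" for g y
    using that by (auto simp: G_def ract_add_left LML MLL)
  have GL: "y \<rhd> g \<in> M.span G" if g: "g \<in> G" for g y
  proof -
    obtain x m where g: "g = (x \<rhd> m) + (m \<lhd> x)" using g by (auto simp: G_def)
    have "y \<rhd> g = (((y \<bullet> x) \<rhd> m) + (m \<lhd> (y \<bullet> x))) + ((x \<rhd> (y \<rhd> m)) + ((y \<rhd> m) \<lhd> x))"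
      by (simp add: g lact_add_right LLM LML)
    moreover have "((y \<bullet> x) \<rhd> m) + (m \<lhd> (y \<bullet> x)) \<in> G" "(x \<rhd> (y \<rhd> m)) + ((y \<rhd> m) \<lhd> x) \<in> G"
      by (auto simp: G_def)
    ultimately show ?thesis by (simp add: M.span_add M.span_base)
  qed
  have R: "v \<lhd> y = 0" if "v \<in> M.span G" for v y
    using that
    by (induction rule: M.span_induct)
      (auto intro!: M.subspaceI simp: ract_add_left ract_scale_left G0)
  have L: "y \<rhd> v \<in> M.span G" if "v \<in> M.span G" for v y
    using that
    by (induction rule: M.span_induct)
      (auto intro!: M.subspaceI simp: lact_add_right lact_scale_right GL
        M.span_zero M.span_add M.span_scale)
  have "subbimodule (M.span G)"
    by (simp add: subbimodule_def L R M.span_zero)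
  then consider "M.span G = {0}" | "M.span G = UNIV"
    using assms(1) by (auto simp: irreducible_bimodule_def)
  then show ?thesis
  proof cases
    case 1
    have "(x \<rhd> m) + (m \<lhd> x) \<in> M.span G"
      by (auto simp: G_def intro: M.span_base)
    then show ?thesis
      using 1 by (simp add: eq_neg_iff_add_eq_0 add.commute)
  next
    \<comment> \<open>Here the whole right action is zero, so faithfulness makes every
      \<open>x\<close> zero.\<close>
    case 2
    then have "x \<in> right_annihilator"
      using R by (simp add: right_annihilator_def)
    then have "x = 0"
      using assms(2) by (simp add: right_faithful_def)
    then show ?thesis by simp
  qed
qed

section \<open>Multilinear maps on lists\<close>

text \<open>No degree is fixed: fixing the first argument stays within the notion, so inductions
  over lists need no length bookkeeping.\<close>

definition multilinear :: "('l list \<Rightarrow> 'm) \<Rightarrow> bool" where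
  "multilinear f \<longleftrightarrow>
     (\<forall>us vs. Vector_Spaces.linear scaleL scaleM (\<lambda>x. f (us @ x # vs)))"

lemma linearI:
  assumes "\<And>x y. f (x + y) = f x + f y" and "\<And>c x. f (c *\<^sub>L x) = c *\<^sub>M f x"
  shows "Vector_Spaces.linear scaleL scaleM f"
  using assms L.vector_space_axioms M.vector_space_axioms by (simp add: Vector_Spaces.linear_iff)

lemma multilinearI:
  assumes "\<And>us vs x y. f (us @ (x + y) # vs) = f (us @ x # vs) + f (us @ y # vs)"
    and "\<And>us vs c x. f (us @ (c *\<^sub>L x) # vs) = c *\<^sub>M f (us @ x # vs)"
  shows "multilinear f"
  unfolding multilinear_def by (intro allI linearI) (simp_all add: assms)

lemma multilinear_add: "multilinear f \<Longrightarrow> f (us @ (x + y) # vs) = f (us @ x # vs) + f (us @ y # vs)"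
  and multilinear_scale: "multilinear f \<Longrightarrow> f (us @ (c *\<^sub>L x) # vs) = c *\<^sub>M f (us @ x # vs)"
  by (simp_all add: multilinear_def Vector_Spaces.linear_iff)

lemmas multilinear_add_Cons = multilinear_add[where us = "[]", simplified]
lemmas multilinear_scale_Cons = multilinear_scale[where us = "[]", simplified]

lemma multilinear_zero_Cons: "multilinear f \<Longrightarrow> f (0 # vs) = 0"
  using multilinear_add_Cons[of f 0 0 vs] by simp

lemma multilinear_Cons: "multilinear f \<Longrightarrow> multilinear (\<lambda>ys. f (x # ys))"
  using multilinear_add[where us = "x # us" for us] multilinear_scale[where us = "x # us" for us]
  by (intro multilinearI) simp_all

lemma multilinear_plus: "multilinear f \<Longrightarrow> multilinear g \<Longrightarrow> multilinear (\<lambda>xs. f xs + g xs)"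
  by (intro multilinearI) (simp_all add: multilinear_add multilinear_scale M.scale_right_distrib)

lemma cochains_iff: "f \<in> cochains n \<longleftrightarrow> multilinear f \<and> (\<forall>xs. length xs \<noteq> n \<longrightarrow> f xs = 0)"
proof (intro iffI conjI)
  assume f: "f \<in> cochains n"
  then show f0: "\<forall>xs. length xs \<noteq> n \<longrightarrow> f xs = 0"
    by (simp add: cochains_def)
  show "multilinear f"
    unfolding multilinear_def
  proof (intro allI)
    fix us vs :: "'l list"
    show "Vector_Spaces.linear scaleL scaleM (\<lambda>x. f (us @ x # vs))"
    proof (cases "length (us @ 0 # vs) = n")
      case True
      moreover from this have "length us < n" by simp
      ultimately have "Vector_Spaces.linear scaleL scaleM (\<lambda>x. f ((us @ 0 # vs)[length us := x]))"
        using f unfolding cochains_def by blast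
      then show ?thesis by simp
    next
      case False
      then show ?thesis
        using f0 by (intro linearI) simp_all
    qed
  qed
next
  assume f: "multilinear f \<and> (\<forall>xs. length xs \<noteq> n \<longrightarrow> f xs = 0)"
  show "f \<in> cochains n"
    unfolding cochains_def
  proof (intro CollectI conjI allI impI)
    show "f xs = 0" if "length xs \<noteq> n" for xs
      using f that by blast
    show "Vector_Spaces.linear scaleL scaleM (\<lambda>x. f (xs[k := x]))" if "length xs = n \<and> k < n" for xs k
      using f that by (simp add: multilinear_def upd_conv_take_nth_drop)
  qed
qed

section \<open>Cartan calculus: Lie derivative and coboundary\<close>

text \<open>The Lie derivative on cochains; \<open>lie_explicit\<close> is its usual formula. The
  recursion says that the commutator of \<open>lie a\<close> with insertion of \<open>x\<close> is
  insertion of \<open>a \<bullet> x\<close>.\<close>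

primrec lie :: "'l \<Rightarrow> ('l list \<Rightarrow> 'm) \<Rightarrow> 'l list \<Rightarrow> 'm" where
  "lie a f [] = a \<rhd> f []"
| "lie a f (x # xs) = lie a (\<lambda>ys. f (x # ys)) xs - f ((a \<bullet> x) # xs)"

text \<open>
  For symmetric bimodules this is the coboundary operator; the recursion is Cartan's formula
  \<open>i\<^sub>x d + d i\<^sub>x = \<theta>\<^sub>x\<close>, where \<open>i\<^sub>x\<close> inserts \<open>x\<close> as first argument and \<open>\<theta>\<^sub>x\<close> is \<^term>\<open>lie x\<close>.
\<close>

primrec cob :: "('l list \<Rightarrow> 'm) \<Rightarrow> 'l list \<Rightarrow> 'm" where
  "cob f [] = 0"
| "cob f (x # xs) = lie x f xs - cob (\<lambda>ys. f (x # ys)) xs"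

lemma lie_add: "lie a (\<lambda>ys. f ys + g ys) xs = lie a f xs + lie a g xs"
  by (induction xs arbitrary: f g) (simp_all add: lact_add_right)

lemma lie_scale: "lie a (\<lambda>ys. c *\<^sub>M f ys) xs = c *\<^sub>M lie a f xs"
  by (induction xs arbitrary: f) (simp_all add: lact_scale_right M.scale_right_diff_distrib)

lemma lie_diff: "lie a (\<lambda>ys. f ys - g ys) xs = lie a f xs - lie a g xs"
  by (induction xs arbitrary: f g) (simp_all add: lact_diff_right)

lemma cob_add: "cob (\<lambda>ys. f ys + g ys) xs = cob f xs + cob g xs"
  by (induction xs arbitrary: f g) (simp_all add: lie_add)

lemma cob_scale: "cob (\<lambda>ys. c *\<^sub>M f ys) xs = c *\<^sub>M cob f xs"
  by (induction xs arbitrary: f) (simp_all add: lie_scale M.scale_right_diff_distrib)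

lemma cob_diff: "cob (\<lambda>ys. f ys - g ys) xs = cob f xs - cob g xs"
  by (induction xs arbitrary: f g) (simp_all add: lie_diff)

lemma lie_cong_length: "(\<And>ys. length ys = length xs \<Longrightarrow> f ys = g ys) \<Longrightarrow> lie a f xs = lie a g xs"
proof (induction xs arbitrary: f g)
  case (Cons x xs)
  have "lie a (\<lambda>ys. f (x # ys)) xs = lie a (\<lambda>ys. g (x # ys)) xs"
    by (rule Cons.IH) (simp add: Cons.prems)
  then show ?case by (simp add: Cons.prems)
qed simp

text \<open>Only values in one degree matter, so a function may be changed freely on lists of other
  lengths.\<close>

lemma cob_cong_length:
  "(\<And>ys. Suc (length ys) = length xs \<Longrightarrow> f ys = g ys) \<Longrightarrow> cob f xs = cob g xs"
proof (induction xs arbitrary: f g)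
  case (Cons x xs)
  have "cob (\<lambda>ys. f (x # ys)) xs = cob (\<lambda>ys. g (x # ys)) xs"
    by (rule Cons.IH) (simp add: Cons.prems)
  moreover have "lie x f xs = lie x g xs"
    by (rule lie_cong_length) (simp add: Cons.prems)
  ultimately show ?case by simp
qed simp

text \<open>Needed for additivity of \<open>cob f\<close> in its first argument, which
  \<open>cob\<close> turns into the index of a Lie derivative.\<close>

lemma lie_add_left: "multilinear f \<Longrightarrow> lie (a + b) f xs = lie a f xs + lie b f xs"
proof (induction xs arbitrary: f)
  case (Cons x xs)
  then show ?case
    using Cons.IH[OF multilinear_Cons[of f x]]
    by (simp add: mult_add_left multilinear_add_Cons)
qed (simp add: lact_add_left)

lemma lie_scale_left: "multilinear f \<Longrightarrow> lie (c *\<^sub>L a) f xs = c *\<^sub>M lie a f xs"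
proof (induction xs arbitrary: f)
  case (Cons x xs)
  then show ?case
    using Cons.IH[OF multilinear_Cons[of f x]]
    by (simp add: mult_scale_left multilinear_scale_Cons M.scale_right_diff_distrib)
qed (simp add: lact_scale_left)

lemma multilinear_lie:
  assumes "multilinear f"
  shows "multilinear (lie a f)"
proof (rule multilinearI)
  fix us vs x y c
  show "lie a f (us @ (x + y) # vs) = lie a f (us @ x # vs) + lie a f (us @ y # vs)"
    using assms
  proof (induction us arbitrary: f)
    case (Cons u us)
    then show ?case
      using Cons.IH[OF multilinear_Cons[of f u]] multilinear_add[of f "(a \<bullet> u) # us"] by simp
  qed (simp add: multilinear_add_Cons lie_add mult_add_right)
  show "lie a f (us @ (c *\<^sub>L x) # vs) = c *\<^sub>M lie a f (us @ x # vs)"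
    using assms
  proof (induction us arbitrary: f)
    case (Cons u us)
    then show ?case
      using Cons.IH[OF multilinear_Cons[of f u]] multilinear_scale[of f "(a \<bullet> u) # us"]
      by (simp add: M.scale_right_diff_distrib)
  qed (simp add: multilinear_scale_Cons lie_scale mult_scale_right M.scale_right_diff_distrib)
qed

lemma multilinear_cob:
  assumes "multilinear f"
  shows "multilinear (cob f)"
proof (rule multilinearI)
  fix us vs x y c
  show "cob f (us @ (x + y) # vs) = cob f (us @ x # vs) + cob f (us @ y # vs)"
    using assms
  proof (induction us arbitrary: f)
    case (Cons u us)
    then show ?case
      using Cons.IH[OF multilinear_Cons[of f u]] multilinear_add[OF multilinear_lie[of f u]] by simp
  qed (simp add: multilinear_add_Cons lie_add_left cob_add)
  show "cob f (us @ (c *\<^sub>L x) # vs) = c *\<^sub>M cob f (us @ x # vs)"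
    using assms
  proof (induction us arbitrary: f)
    case (Cons u us)
    then show ?case
      using Cons.IH[OF multilinear_Cons[of f u]] multilinear_scale[OF multilinear_lie[of f u]]
      by (simp add: M.scale_right_diff_distrib)
  qed (simp add: multilinear_scale_Cons lie_scale_left cob_scale M.scale_right_diff_distrib)
qed

text \<open>The Lie derivatives represent the algebra: \<open>LLM\<close> gives this for values in
  \<open>M\<close>, and the Leibniz identity for each argument.\<close>

lemma lie_commutator:
  assumes "multilinear f"
  shows "lie a (lie b f) xs - lie b (lie a f) xs = lie (a \<bullet> b) f xs"
  using assms
proof (induction xs arbitrary: f)
  case Nil
  then show ?case by (simp add: LLM)
next
  case (Cons x xs)
  have "f ((a \<bullet> (b \<bullet> x)) # xs) = f (((a \<bullet> b) \<bullet> x) # xs) + f ((b \<bullet> (a \<bullet> x)) # xs)"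
    using Cons.prems by (simp add: leibniz[of a b x] multilinear_add_Cons)
  then show ?case
    using Cons.IH[OF multilinear_Cons[OF Cons.prems, of x]]
    by (simp add: lie_diff algebra_simps)
qed

text \<open>Expanding both sides at a first argument \<open>x\<close> by Cartan's formula leaves
  \<open>lie_commutator\<close> for \<open>a\<close> and \<open>x\<close>, and the induction
  hypothesis with \<open>x\<close> inserted.\<close>

lemma lie_cob:
  assumes "multilinear f"
  shows "lie a (cob f) xs = cob (lie a f) xs"
  using assms
proof (induction xs arbitrary: f)
  case Nil
  then show ?case by simp
next
  case (Cons x xs)
  then show ?case
    using lie_commutator[OF Cons.prems, of a x xs] Cons.IH[OF multilinear_Cons[OF Cons.prems, of x]]
    by (simp add: lie_diff cob_diff algebra_simps)
qed

text \<open>By Cartan's formula, the value at \<open>x # xs\<close> is the commutator of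
  \<open>lie x\<close> and \<open>cob\<close>, which is zero, plus the same claim with
  \<open>x\<close> inserted.\<close>

lemma cob_cob:
  assumes "multilinear f"
  shows "cob (cob f) xs = 0"
  using assms
proof (induction xs arbitrary: f)
  case (Cons x xs)
  then show ?case
    using Cons.IH[OF multilinear_Cons[OF Cons.prems, of x]] lie_cob[OF Cons.prems, of x xs]
    by (simp add: cob_diff)
qed simp

section \<open>Comparison with the explicit coboundary map\<close>

lemma lie_explicit: "lie a f xs = (a \<rhd> f xs) - (\<Sum>j<length xs. f (xs[j := a \<bullet> xs ! j]))"
  by (induction xs arbitrary: f) (simp_all add: sum.lessThan_Suc_shift algebra_simps del: sum.lessThan_Suc)

text \<open>The terms in which the first argument acts or multiplies form its Lie derivative; the
  others are minus the coboundary with that argument inserted. Symmetry enters in degree 0, where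
  the right action must become the left one.\<close>

lemma coboundary_map_eq_cob:
  assumes sym: "\<And>x m. m \<lhd> x = - (x \<rhd> m)" and "length xs = Suc n"
  shows "coboundary_map n f xs = cob f xs"
  using assms(2)
proof (induction n arbitrary: f xs)
  case 0
  then obtain x where "xs = [x]" by (auto simp: length_Suc_conv)
  then show ?case unfolding coboundary_map_def by (simp add: sym)
next
  case (Suc n)
  then obtain x zs where xs: "xs = x # zs" and zs: "length zs = Suc n"
    by (auto simp: length_Suc_conv)
  let ?g = "\<lambda>ys. f (x # ys)"
  have 1: "(\<Sum>j<Suc n. (- 1) ^ j *\<^sub>M (xs ! j \<rhd> f (omit j xs)))
      = (x \<rhd> f zs) - (\<Sum>j<n. (- 1) ^ j *\<^sub>M (zs ! j \<rhd> ?g (omit j zs)))"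
    by (simp add: sum.lessThan_Suc_shift xs omit_def sum_negf del: sum.lessThan_Suc)
  have 2: "(\<Sum>j\<le>Suc n. \<Sum>i<j. (- 1) ^ (i + 1) *\<^sub>M f (omit i (xs[j := xs ! i \<bullet> xs ! j])))
      = - (\<Sum>j\<le>n. f (zs[j := x \<bullet> zs ! j]))
        - (\<Sum>j\<le>n. \<Sum>i<j. (- 1) ^ (i + 1) *\<^sub>M ?g (omit i (zs[j := zs ! i \<bullet> zs ! j])))"
    by (simp add: sum.atMost_Suc_shift sum.lessThan_Suc_shift xs omit_def sum_negf sum_subtractf
      del: sum.lessThan_Suc sum.atMost_Suc)
  have "coboundary_map (Suc n) f xs = lie x f zs - coboundary_map n ?g zs"
    using 1 2 zs unfolding coboundary_map_def lie_explicit
    by (simp add: xs lessThan_Suc_atMost del: sum.lessThan_Suc sum.atMost_Suc)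
  then show ?case using Suc.IH[OF zs, of ?g] by (simp add: xs)
qed

section \<open>Inverting the Lie derivative\<close>

text \<open>
  If \<open>p\<close> inverts the action of \<open>a\<close> and \<open>a \<bullet> (a \<bullet> x) = 0\<close>, this inverts \<^term>\<open>lie a\<close> on cochains of
  degree \<open>n\<close>: the equation \<open>lie a u = f\<close> yields \<open>u (a \<bullet> x, \<dots>)\<close> from \<open>f (a \<bullet> x, \<dots>)\<close>, and then
  \<open>u (x, \<dots>)\<close> from \<open>f (x, \<dots>) + u (a \<bullet> x, \<dots>)\<close>.
\<close>

primrec lie_inv :: "('m \<Rightarrow> 'm) \<Rightarrow> 'l \<Rightarrow> nat \<Rightarrow> ('l list \<Rightarrow> 'm) \<Rightarrow> 'l list \<Rightarrow> 'm" where
  "lie_inv p a 0 f = (\<lambda>xs. p (f xs))"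
| "lie_inv p a (Suc n) f = (\<lambda>xs. case xs of [] \<Rightarrow> 0 | x # xs \<Rightarrow>
     lie_inv p a n (\<lambda>ys. f (x # ys) + lie_inv p a n (\<lambda>zs. f ((a \<bullet> x) # zs)) ys) xs)"

context
  fixes p :: "'m \<Rightarrow> 'm" and a :: 'l
  assumes p: "Vector_Spaces.linear scaleM scaleM p"
    and a_p: "\<And>m. a \<rhd> p m = m"
    and inj_a: "\<And>m. a \<rhd> m = 0 \<Longrightarrow> m = 0"
    and a_a: "\<And>x. a \<bullet> (a \<bullet> x) = 0"
begin

lemma lie_inv_add: "lie_inv p a n (\<lambda>ys. f ys + g ys) = (\<lambda>xs. lie_inv p a n f xs + lie_inv p a n g xs)"
proof (induction n arbitrary: f g)
  case 0
  then show ?case using p by (simp add: Vector_Spaces.linear_iff)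
next
  case (Suc n)
  show ?case by (rule ext) (simp add: Suc split: list.split)
qed

lemma lie_inv_scale: "lie_inv p a n (\<lambda>ys. c *\<^sub>M f ys) = (\<lambda>xs. c *\<^sub>M lie_inv p a n f xs)"
proof (induction n arbitrary: f)
  case 0
  then show ?case using p by (simp add: Vector_Spaces.linear_iff)
next
  case (Suc n)
  show ?case
    by (rule ext) (simp add: Suc lie_inv_add M.scale_right_distrib split: list.split)
qed

lemma lie_inv_zero: "lie_inv p a n (\<lambda>_. 0) = (\<lambda>_. 0)"
  using lie_inv_scale[of n 0 "\<lambda>_. 0"] by simp

lemma multilinear_lie_inv: "multilinear f \<Longrightarrow> multilinear (lie_inv p a n f)"
proof (induction n arbitrary: f)
  case 0
  then show ?case
    using p by (intro multilinearI) (simp_all add: Vector_Spaces.linear_iff multilinear_add multilinear_scale)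
next
  case (Suc n)
  have *: "multilinear (lie_inv p a n (\<lambda>ys. f (u # ys) + lie_inv p a n (\<lambda>zs. f ((a \<bullet> u) # zs)) ys))"
    for u
    by (intro Suc multilinear_plus multilinear_Cons)
  show ?case
  proof (rule multilinearI)
    fix us vs x y c
    show "lie_inv p a (Suc n) f (us @ (x + y) # vs)
        = lie_inv p a (Suc n) f (us @ x # vs) + lie_inv p a (Suc n) f (us @ y # vs)"
      using Suc.prems
      by (cases us)
        (simp_all add: mult_add_right multilinear_add_Cons lie_inv_add multilinear_add[OF *[unfolded lie_inv_add]])
    show "lie_inv p a (Suc n) f (us @ (c *\<^sub>L x) # vs) = c *\<^sub>M lie_inv p a (Suc n) f (us @ x # vs)"
      using Suc.prems
      by (cases us)
        (simp_all add: mult_scale_right multilinear_scale_Cons lie_inv_add lie_inv_scale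
          M.scale_right_distrib multilinear_scale[OF *[unfolded lie_inv_add]])
  qed
qed

lemma lie_lie_inv: "multilinear f \<Longrightarrow> length xs = n \<Longrightarrow> lie a (lie_inv p a n f) xs = f xs"
proof (induction n arbitrary: f xs)
  case 0
  then show ?case by (simp add: a_p)
next
  case (Suc n)
  then obtain x zs where xs: "xs = x # zs" "length zs = n" by (auto simp: length_Suc_conv)
  let ?h = "\<lambda>zs. f ((a \<bullet> x) # zs)"
  have "multilinear (\<lambda>ys. f (x # ys) + lie_inv p a n ?h ys)"
    using Suc.prems by (intro multilinear_plus multilinear_lie_inv multilinear_Cons)
  \<comment> \<open>As \<open>a \<bullet> (a \<bullet> x) = 0\<close>, the inverse evaluated at
    \<open>(a \<bullet> x) # zs\<close> is just \<open>lie_inv p a n ?h zs\<close>, which cancels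
    the correction term added to \<open>f (x # zs)\<close>.\<close>
  then show ?case
    using Suc.IH[of "\<lambda>ys. f (x # ys) + lie_inv p a n ?h ys" zs] xs Suc.prems(1)
    by (simp add: a_a multilinear_zero_Cons lie_inv_zero)
qed

text \<open>The same two stages as in \<open>lie_inv\<close>: first \<open>f\<close> vanishes when
  the first argument is some \<open>a \<bullet> x\<close>, because
  \<open>a \<bullet> (a \<bullet> x) = 0\<close>; then it vanishes for every
  \<open>x\<close>.\<close>

lemma lie_eq_0_imp:
  assumes "multilinear f" and "\<And>xs. length xs = n \<Longrightarrow> lie a f xs = 0" and "length xs = n"
  shows "f xs = 0"
  using assms
proof (induction n arbitrary: f xs)
  case 0
  then show ?case using inj_a[of "f []"] by (metis lie.simps(1) length_0_conv)
next
  case (Suc n)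
  then obtain x zs where xs: "xs = x # zs" "length zs = n" by (auto simp: length_Suc_conv)
  have eq: "lie a (\<lambda>ys. f (y # ys)) ys = f ((a \<bullet> y) # ys)" if "length ys = n" for y ys
    using Suc.prems(2)[of "y # ys"] that by simp
  have "f ((a \<bullet> x) # ys) = 0" if "length ys = n" for ys
    using that eq Suc.prems(1)
    by (intro Suc.IH[of "\<lambda>ys. f ((a \<bullet> x) # ys)"] multilinear_Cons)
      (simp_all add: a_a multilinear_zero_Cons)
  then show ?case
    using eq Suc.prems(1) xs Suc.IH[of "\<lambda>ys. f (x # ys)" zs] by (simp add: multilinear_Cons)
qed

text \<open>Let \<open>u\<close> be the preimage of \<open>f\<close> under \<open>lie a\<close>.
  Then \<open>lie a (cob u) = cob f = 0\<close> in degree \<open>n + 1\<close>, so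
  \<open>cob u = 0\<close> there, and Cartan's formula makes \<open>f\<close> the coboundary of
  \<open>u\<close> with \<open>a\<close> inserted.\<close>

lemma cocycles_subset_coboundaries:
  assumes sym: "\<And>x m. m \<lhd> x = - (x \<rhd> m)"
  shows "cocycles n \<subseteq> coboundaries n"
proof
  fix f assume "f \<in> cocycles n"
  then have f: "multilinear f" and f0: "\<And>xs. length xs \<noteq> n \<Longrightarrow> f xs = 0"
    and cob_map: "coboundary_map n f = (\<lambda>_. 0)"
    by (auto simp: cocycles_def cochains_iff)
  have "cob f xs = 0" if "length xs = Suc n" for xs
    using that coboundary_map_eq_cob[OF sym that, of f] cob_map by simp
  moreover define u where "u = lie_inv p a n f"
  have lin_u: "multilinear u"
    using f by (simp add: u_def multilinear_lie_inv)
  have lie_u: "lie a u xs = f xs" if "length xs = n" for xs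
    using f that by (simp add: u_def lie_lie_inv)
  then have "cob (lie a u) xs = cob f xs" if "length xs = Suc n" for xs
    using that by (intro cob_cong_length) simp
  ultimately have "lie a (cob u) xs = 0" if "length xs = Suc n" for xs
    using that lin_u by (simp add: lie_cob)
  then have cob_u: "cob u xs = 0" if "length xs = Suc n" for xs
    using that lie_eq_0_imp[OF multilinear_cob[OF lin_u]] by blast
  have eq: "f xs = cob (\<lambda>ys. u (a # ys)) xs" if "length xs = n" for xs
    using cob_u[of "a # xs"] lie_u that by simp
  show "f \<in> coboundaries n"
  proof (cases n)
    case 0
    \<comment> \<open>\<open>cob\<close> is zero on the empty list.\<close>
    then have "f xs = 0" for xs
      using eq[of xs] f0[of xs] by (cases xs) simp_all
    then show ?thesis by (auto simp: 0 coboundaries_def)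
  next
    case (Suc k)
    \<comment> \<open>Cut off to length \<open>k\<close>, since \<open>u\<close> is not known to
      vanish in other degrees.\<close>
    define g where "g ys = (if length ys = k then u (a # ys) else 0)" for ys
    have "multilinear g"
      using multilinear_add[OF lin_u, of "a # us" for us] multilinear_scale[OF lin_u, of "a # us" for us]
      by (intro multilinearI) (auto simp: g_def)
    then have "g \<in> cochains k"
      by (simp add: cochains_iff g_def)
    moreover have "f xs = coboundary_map k g xs" for xs
    proof (cases "length xs = n")
      case True
      then have "cob g xs = cob (\<lambda>ys. u (a # ys)) xs"
        by (intro cob_cong_length) (simp add: g_def Suc)
      then show ?thesis
        using True eq[OF True] coboundary_map_eq_cob[OF sym, of xs k g] Suc by simp
    next
      case False
      then show ?thesis by (simp add: f0 Suc coboundary_map_def)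
    qed
    ultimately show ?thesis by (auto simp: Suc coboundaries_def)
  qed
qed

end

section \<open>Coboundaries and the zero coset\<close>

lemma coboundaries_subset_cocycles:
  assumes sym: "\<And>x m. m \<lhd> x = - (x \<rhd> m)"
  shows "coboundaries n \<subseteq> cocycles n"
proof
  fix f assume f: "f \<in> coboundaries n"
  show "f \<in> cocycles n"
  proof (cases n)
    case 0
    then show ?thesis
      using f by (auto simp: coboundaries_def cocycles_def cochains_iff coboundary_map_def
        intro!: multilinearI)
  next
    case (Suc k)
    then obtain g where g: "multilinear g" "\<And>ys. length ys \<noteq> k \<Longrightarrow> g ys = 0"
      and fg: "f = coboundary_map k g"
      using f by (auto simp: coboundaries_def cochains_iff)
    have f_cob: "f xs = cob g xs" if "length xs = n" for xs
      using that by (simp add: Suc fg coboundary_map_eq_cob[OF sym])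
    have f0: "f xs = 0" if "length xs \<noteq> n" for xs
      using that by (simp add: Suc fg coboundary_map_def)
    have "multilinear f"
    proof (rule multilinearI)
      fix us vs x y c
      show "f (us @ (x + y) # vs) = f (us @ x # vs) + f (us @ y # vs)"
        by (cases "length (us @ x # vs) = n")
          (simp_all add: f_cob f0 multilinear_add[OF multilinear_cob[OF g(1)]])
      show "f (us @ (c *\<^sub>L x) # vs) = c *\<^sub>M f (us @ x # vs)"
        by (cases "length (us @ x # vs) = n")
          (simp_all add: f_cob f0 multilinear_scale[OF multilinear_cob[OF g(1)]])
    qed
    moreover have "coboundary_map n f xs = 0" for xs
    proof (cases "length xs = Suc n")
      case True
      then have "cob f xs = cob (cob g) xs"
        by (intro cob_cong_length) (simp add: f_cob)
      then show ?thesis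
        using True by (simp add: coboundary_map_eq_cob[OF sym] cob_cob[OF g(1)])
    qed (simp add: coboundary_map_def)
    ultimately show ?thesis
      by (auto simp: cocycles_def cochains_iff f0)
  qed
qed

lemma zero_coboundary: "(\<lambda>_. 0) \<in> coboundaries n"
proof (cases n)
  case (Suc k)
  have "coboundary_map k (\<lambda>_. 0) = (\<lambda>_. 0)"
    by (simp add: coboundary_map_def fun_eq_iff)
  moreover have "(\<lambda>_. 0) \<in> cochains k"
    by (auto simp: cochains_iff intro!: multilinearI)
  ultimately show ?thesis
    using image_eqI[of "\<lambda>_. 0" "coboundary_map k" "\<lambda>_. 0"] by (simp add: Suc coboundaries_def)
qed (simp add: coboundaries_def)

lemma diff_coboundary:
  assumes sym: "\<And>x m. m \<lhd> x = - (x \<rhd> m)"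
    and "f \<in> coboundaries n" "g \<in> coboundaries n"
  shows "(\<lambda>xs. f xs - g xs) \<in> coboundaries n"
proof (cases n)
  case 0
  then show ?thesis using assms by (simp add: coboundaries_def)
next
  case (Suc k)
  then obtain f' g' where f': "f' \<in> cochains k" "f = coboundary_map k f'"
    and g': "g' \<in> cochains k" "g = coboundary_map k g'"
    using assms by (auto simp: coboundaries_def)
  have "multilinear (\<lambda>xs. f' xs - g' xs)"
    using f'(1) g'(1)
    by (intro multilinearI)
      (simp_all add: cochains_iff multilinear_add multilinear_scale M.scale_right_diff_distrib)
  then have "(\<lambda>xs. f' xs - g' xs) \<in> cochains k"
    using f'(1) g'(1) by (simp add: cochains_iff)
  moreover have "f xs - g xs = coboundary_map k (\<lambda>xs. f' xs - g' xs) xs" for xs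
  proof (cases "length xs = Suc k")
    case True
    then show ?thesis
      by (simp add: f' g' coboundary_map_eq_cob[OF sym] cob_diff)
  next
    case False
    then show ?thesis by (simp add: f' g' coboundary_map_def)
  qed
  ultimately show ?thesis by (auto simp: Suc coboundaries_def)
qed

text \<open>If every cocycle is a coboundary, all differences of cocycles are coboundaries and there
  is a single class; it exists because zero is a coboundary.\<close>

lemma HL_trivialI:
  assumes sym: "\<And>x m. m \<lhd> x = - (x \<rhd> m)" and "cocycles n \<subseteq> coboundaries n"
  shows "HL n = {coboundaries n}"
proof -
  have eq: "cocycles n = coboundaries n"
    using assms(2) coboundaries_subset_cocycles[OF sym] by blast
  have "cohomologous n `` {f} = coboundaries n" if "f \<in> coboundaries n" for f
    using that diff_coboundary[OF sym] by (auto simp: cohomologous_def eq)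
  then show ?thesis
    using zero_coboundary by (auto simp: HL_def quotient_def eq)
qed

section \<open>An ideal element acting injectively\<close>

lemma ex_finite_basis:
  assumes finite_dimensional
  obtains B where "finite_dimensional_vector_space scaleM B"
proof -
  obtain C where "finite C" "M.span C = UNIV"
    using assms by (auto simp: finite_dimensional_def)
  then obtain B where "finite B" "M.independent B" "M.span B = UNIV"
    using M.maximal_independent_subset[of C]
    by (metis M.span_mono M.span_span finite_subset top.extremum_uniqueI)
  then have "finite_dimensional_vector_space scaleM B"
    by unfold_locales auto
  then show ?thesis by (rule that)
qed

text \<open>
  The Fitting null component of \<open>a\<close> on \<open>M\<close> is a subbimodule, because \<open>a \<bullet> x\<close> commutes with \<open>a\<close>.
  It cannot be \<open>M\<close> for all \<open>a \<in> A\<close>: a non-zero \<open>A\<close>-invariant subspace of minimal dimension would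
  be annihilated by \<open>A\<close>, and the vectors annihilated by \<open>A\<close> form a subbimodule.
\<close>

lemma ex_injective_lact:
  assumes sym: "\<And>x m. m \<lhd> x = - (x \<rhd> m)"
    and finite_dimensional and irreducible_bimodule and right_faithful
    and A: "A \<noteq> {0}" "L.subspace A" "\<And>x a. a \<in> A \<Longrightarrow> a \<bullet> x \<in> A"
      "\<And>a b. a \<in> A \<Longrightarrow> b \<in> A \<Longrightarrow> a \<bullet> b = 0"
  obtains a where "a \<in> A" "\<And>m. a \<rhd> m = 0 \<Longrightarrow> m = 0"
proof (rule ccontr)
  assume "\<not> thesis"
  with that have not_inj: "\<exists>m. a \<rhd> m = 0 \<and> m \<noteq> 0" if "a \<in> A" for a
    using \<open>a \<in> A\<close> by blast
  obtain B where "finite_dimensional_vector_space scaleM B"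
    using ex_finite_basis[OF assms(2)] .
  then interpret F: finite_dimensional_vector_space scaleM B .
  \<comment> \<open>By symmetry a subspace stable under the left action is a subbimodule.\<close>
  have irr: "N = UNIV"
    if "M.subspace N" "\<And>x m. m \<in> N \<Longrightarrow> x \<rhd> m \<in> N" "m \<in> N" "m \<noteq> 0" for N m
  proof -
    have "subbimodule N"
      using that(1,2) by (auto simp: subbimodule_def sym M.subspace_neg)
    then show ?thesis
      using assms(3) that(3,4) by (auto simp: irreducible_bimodule_def)
  qed
  have comm: "a \<rhd> (b \<rhd> m) = b \<rhd> (a \<rhd> m)" if "a \<in> A" "b \<in> A" for a b m
    using LLM[of a b m] A(4)[OF that] by simp
  have pow_add: "((\<rhd>) a ^^ k) (m + m') = ((\<rhd>) a ^^ k) m + ((\<rhd>) a ^^ k) m'" for a k m m'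
    by (induction k) (simp_all add: lact_add_right)
  have pow_scale: "((\<rhd>) a ^^ k) (c *\<^sub>M m) = c *\<^sub>M ((\<rhd>) a ^^ k) m" for a k c m
    by (induction k) (simp_all add: lact_scale_right)
  have pow_0: "((\<rhd>) a ^^ k) 0 = 0" for a k
    by (induction k) simp_all
  have pow_mono: "((\<rhd>) a ^^ (j + k)) m = 0" if "((\<rhd>) a ^^ k) m = 0" for a j k m
    using that by (simp add: funpow_add pow_0)
  have pow_comm: "((\<rhd>) a ^^ k) (b \<rhd> m) = b \<rhd> ((\<rhd>) a ^^ k) m" if "a \<in> A" "b \<in> A" for a b k m
    using that by (induction k) (simp_all add: comm)
  \<comment> \<open>One more power suffices: in \<open>a \<rhd> (x \<rhd> m) = (x \<rhd> (a \<rhd>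
    m)) + ((a \<bullet> x) \<rhd> m)\<close> the first term falls to induction, and in the second
    \<open>a \<bullet> x\<close> commutes with \<open>a\<close>.\<close>
  have pow_lact: "((\<rhd>) a ^^ Suc k) (x \<rhd> m) = 0" if a: "a \<in> A" and m: "((\<rhd>) a ^^ k) m = 0" for a k x m
    using m
  proof (induction k arbitrary: m)
    case 0
    then show ?case by simp
  next
    case (Suc k)
    have 1: "((\<rhd>) a ^^ k) (a \<rhd> m) = 0"
      using Suc.prems by (simp add: funpow_swap1)
    have "((\<rhd>) a ^^ Suc k) ((a \<bullet> x) \<rhd> m) = (a \<bullet> x) \<rhd> ((\<rhd>) a ^^ Suc k) m"
      by (rule pow_comm[OF a A(3)[OF a]])
    also have "\<dots> = 0" by (simp only: Suc.prems lact_zero_right)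
    finally have 2: "((\<rhd>) a ^^ Suc k) ((a \<bullet> x) \<rhd> m) = 0" .
    have "a \<rhd> (x \<rhd> m) = (x \<rhd> (a \<rhd> m)) + ((a \<bullet> x) \<rhd> m)"
      by (simp add: LLM)
    then have "((\<rhd>) a ^^ Suc (Suc k)) (x \<rhd> m)
        = ((\<rhd>) a ^^ Suc k) ((x \<rhd> (a \<rhd> m)) + ((a \<bullet> x) \<rhd> m))"
      by (simp only: funpow_Suc_right o_apply)
    then show ?case
      by (simp only: pow_add 2 Suc.IH[OF 1] add_0)
  qed
  have nil: "\<exists>k. ((\<rhd>) a ^^ k) m = 0" if a: "a \<in> A" for a m
  proof -
    let ?N = "{m. \<exists>k. ((\<rhd>) a ^^ k) m = 0}"
    obtain m0 where m0: "a \<rhd> m0 = 0" "m0 \<noteq> 0"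
      using not_inj[OF a] by blast
    have sub: "M.subspace ?N"
    proof (rule M.subspaceI)
      fix v w assume "v \<in> ?N" "w \<in> ?N"
      then obtain j k where "((\<rhd>) a ^^ j) v = 0" "((\<rhd>) a ^^ k) w = 0" by blast
      then have "((\<rhd>) a ^^ (k + j)) (v + w) = 0"
        using pow_mono[where j = k and k = j] pow_mono[where j = j and k = k] by (simp add: pow_add add.commute)
      then show "v + w \<in> ?N" by blast
    qed (use pow_0 pow_scale in \<open>auto intro: exI[of _ 0]\<close>)
    have "((\<rhd>) a ^^ 1) m0 = 0" using m0 by simp
    then have "m0 \<in> ?N" by blast
    then have "?N = UNIV"
      using irr[OF sub] m0(2) pow_lact[OF a] by blast
    then show ?thesis by blast
  qed
  \<comment> \<open>The non-zero \<open>A\<close>-invariant subspaces; one of least dimension is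
    chosen.\<close>
  define I where "I W \<longleftrightarrow> M.subspace W \<and> W \<noteq> {0} \<and> (\<forall>a\<in>A. \<forall>m\<in>W. a \<rhd> m \<in> W)" for W
  have "I UNIV"
    using assms(3) by (simp add: I_def irreducible_bimodule_def)
  then obtain W where W: "I W" and W_min: "\<And>V. I V \<Longrightarrow> M.dim W \<le> M.dim V"
    using ex_has_least_nat[of I UNIV M.dim] by blast
  have AW: "a \<rhd> w = 0" if a: "a \<in> A" and w: "w \<in> W" for a w
  proof -
    let ?V = "{v \<in> W. a \<rhd> v = 0}"
    have sub: "M.subspace ?V"
      using W by (auto simp: I_def lact_add_right lact_scale_right M.subspace_def)
    obtain v where v: "v \<in> W" "v \<noteq> 0"
      using W M.subspace_0 by (auto simp: I_def)
    \<comment> \<open>The last non-zero power of \<open>a\<close> applied to \<open>v\<close> lies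
      in the kernel of \<open>a\<close> on \<open>W\<close>. This kernel is
      \<open>A\<close>-invariant, so minimality makes it \<open>W\<close>.\<close>
    define k where "k = (LEAST k. ((\<rhd>) a ^^ k) v = 0)"
    have k: "((\<rhd>) a ^^ k) v = 0"
      unfolding k_def using nil[OF a] by (rule LeastI_ex)
    with v obtain j where j: "k = Suc j" by (cases k) auto
    have "((\<rhd>) a ^^ j) v \<noteq> 0"
      using not_less_Least[of j "\<lambda>k. ((\<rhd>) a ^^ k) v = 0"] j by (simp add: k_def)
    moreover have "((\<rhd>) a ^^ i) v \<in> W" for i
      using W a v by (induction i) (auto simp: I_def)
    ultimately have "?V \<noteq> {0}"
      using k j by auto
    then have "I ?V"
      using sub W a comm by (auto simp: I_def)
    then have "?V = W"
      using sub W W_min by (intro F.subspace_dim_equal) (auto simp: I_def)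
    then show ?thesis using w by blast
  qed
  let ?K = "{m. \<forall>a\<in>A. a \<rhd> m = 0}"
  have sub: "M.subspace ?K"
    by (auto simp: lact_add_right lact_scale_right M.subspace_def)
  \<comment> \<open>Moving \<open>a\<close> past \<open>x\<close> costs
    \<open>(a \<bullet> x) \<rhd> m\<close>, which is zero because \<open>a \<bullet> x\<close> is
    in \<open>A\<close>.\<close>
  have "x \<rhd> m \<in> ?K" if "m \<in> ?K" for x m
  proof (intro CollectI ballI)
    fix a assume "a \<in> A"
    then show "a \<rhd> (x \<rhd> m) = 0"
      using that A(3)[of a x] LLM[of a x m] by simp
  qed
  moreover obtain w where "w \<in> W" "w \<noteq> 0"
    using W M.subspace_0 by (auto simp: I_def)
  ultimately have "?K = UNIV"
    using irr[OF sub] AW by blast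
  then have "a \<in> right_annihilator" if "a \<in> A" for a
    using that by (auto simp: right_annihilator_def sym)
  then have "A \<subseteq> {0}"
    using assms(4) by (auto simp: right_faithful_def)
  then show False
    using A(1,2) L.subspace_0 by blast
qed

section \<open>Vanishing of the cohomology\<close>

lemma HL_eq_0:
  assumes solvable finite_dimensional right_faithful irreducible_bimodule
    and L0: "(UNIV :: 'l set) \<noteq> {0}"
  shows "HL n = {coboundaries n}"
proof -
  have sym: "m \<lhd> x = - (x \<rhd> m)" for x m
    using assms by (intro irreducible_right_faithful_symmetric)
  have faithful: "x = 0" if "\<And>m. x \<rhd> m = 0" for x
    using that assms(3) by (auto simp: right_faithful_def right_annihilator_def sym)
  \<comment> \<open>By \<open>LLM\<close> the element \<open>x \<bullet> y + y \<bullet> x\<close>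
    acts as zero. Anticommutativity then makes the left ideal \<open>A\<close> two-sided.\<close>
  have anticomm: "x \<bullet> y = - (y \<bullet> x)" for x y
  proof -
    have "(x \<bullet> y + y \<bullet> x) \<rhd> m = 0" for m
      by (simp add: lact_add_left LLM)
    then show ?thesis
      using faithful by (simp add: eq_neg_iff_add_eq_0)
  qed
  obtain A where A: "L.subspace A" "A \<noteq> {0}" "\<And>x a. a \<in> A \<Longrightarrow> x \<bullet> a \<in> A"
    "\<And>a b. a \<in> A \<Longrightarrow> b \<in> A \<Longrightarrow> a \<bullet> b = 0"
    using ex_abelian_left_ideal[OF assms(1) L0] by blast
  have right: "a \<bullet> x \<in> A" if "a \<in> A" for a x
    using A(1) A(3)[OF that, of x] by (simp add: anticomm[of a x] L.subspace_neg)
  obtain a where a: "a \<in> A" and inj_a: "\<And>m. a \<rhd> m = 0 \<Longrightarrow> m = 0"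
    using ex_injective_lact[OF sym assms(2,4,3) A(2,1) right A(4)] by blast
  obtain B where "finite_dimensional_vector_space scaleM B"
    using ex_finite_basis[OF assms(2)] .
  then interpret F: finite_dimensional_vector_space scaleM B .
  have inj: "inj ((\<rhd>) a)"
    using inj_a by (metis injI lact_diff_right right_minus_eq)
  then have surj: "surj ((\<rhd>) a)"
    by (rule F.linear_inj_imp_surj[OF linear_lact_right])
  define p where "p = inv ((\<rhd>) a)"
  have a_p: "a \<rhd> p m = m" for m
    unfolding p_def using surj by (rule surj_f_inv_f)
  have "p (m + m') = p m + p m'" "p (c *\<^sub>M m) = c *\<^sub>M p m" for m m' c
    by (rule injD[OF inj], simp add: lact_add_right lact_scale_right a_p)+
  then have "Vector_Spaces.linear scaleM scaleM p"
    using M.vector_space_axioms by (simp add: Vector_Spaces.linear_iff)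
  then show ?thesis
    \<comment> \<open>The condition \<open>a \<bullet> (a \<bullet> x) = 0\<close> holds since
      \<open>a\<close> and \<open>a \<bullet> x\<close> both lie in the abelian ideal
      \<open>A\<close>.\<close>
    using a right A(4) a_p inj_a
    by (intro HL_trivialI cocycles_subset_coboundaries[of p a] sym) auto
qed

text \<open>In positive degree a multilinear map on the zero algebra has a zero argument, so there
  are no non-zero cochains.\<close>

lemma HL_zero_algebra:
  assumes irreducible_bimodule right_faithful and z: "(UNIV :: 'l set) = {0}" and "n \<noteq> 0"
  shows "HL n = {coboundaries n}"
proof (rule HL_trivialI)
  show "m \<lhd> x = - (x \<rhd> m)" for x m
    using assms by (intro irreducible_right_faithful_symmetric)
  have "f = (\<lambda>_. 0)" if "f \<in> cochains n" for f
  proof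
    fix xs
    show "f xs = 0"
    proof (cases xs)
      case (Cons x ys)
      have "x = 0" using z by blast
      then show ?thesis
        using that Cons by (simp add: cochains_iff multilinear_zero_Cons)
    qed (use that \<open>n \<noteq> 0\<close> in \<open>simp add: cochains_iff\<close>)
  qed
  then show "cocycles n \<subseteq> coboundaries n"
    using zero_coboundary by (auto simp: cocycles_def)
qed

end

theorem theorem4p10:
  fixes scaleL :: "'f::field \<Rightarrow> 'l::ab_group_add \<Rightarrow> 'l"
    and mult :: "'l \<Rightarrow> 'l \<Rightarrow> 'l"
    and scaleM :: "'f \<Rightarrow> 'm::ab_group_add \<Rightarrow> 'm"
    and lact :: "'l \<Rightarrow> 'm \<Rightarrow> 'm"
    and ract :: "'m \<Rightarrow> 'l \<Rightarrow> 'm"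
    and n :: nat
  assumes "left_leibniz_algebra scaleL mult"
    and "left_leibniz_algebra.solvable scaleL mult"
    and "leibniz_bimodule scaleL mult scaleM lact ract"
    and "leibniz_bimodule.finite_dimensional scaleM"
    and "leibniz_bimodule.right_faithful ract"
    and "leibniz_bimodule.irreducible_bimodule scaleM lact ract"
    and nonzero_algebra: "n = 0 \<Longrightarrow> (UNIV :: 'l set) \<noteq> {0}"
  shows "leibniz_bimodule.HL scaleL mult scaleM lact ract n
         = {leibniz_bimodule.coboundaries scaleL mult scaleM lact ract n}"
proof -
  interpret leibniz_bimodule scaleL mult scaleM lact ract by fact
  \<comment> \<open>Cases on whether the algebra is zero; if it is, \<open>nonzero_algebra\<close>
    forces \<open>n \<noteq> 0\<close>.\<close>
  show ?thesis
    using assms HL_eq_0 HL_zero_algebra by metis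
qed

end
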